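(* Let $X_1,X_2,\dots$ be any sequence of (possibly correlated) random variables with $\mathrm{Var}(X_i)<+\infty$ for $i=1,2,\dots$. Suppose that at least one of the following two conditions holds: (1) $\mathrm{Var}(X_n)\to0$ as $n\to+\infty$; (2) there exist $C>0$ and $0<s<1$ such that both (a) and (b) hold: (a) either $\big|\frac1n\sum_{i=1}^n\mathrm{Var}(X_i)\big|<C$ for all $n$, or $\big|\frac1n\sum_{i=1}^n\mathrm{Var}(X_i)\big|=O(n^s)$; (b) either $\big|\frac1n\sum_{1\le i<j\le n}\mathrm{Cov}(X_i,X_j)\big|<C$ for all $n$, or $\big|\frac1n\sum_{1\le i<j\le n}\mathrm{Cov}(X_i,X_j)\big|=O(n^s)$. Then for any $\varepsilon>0$, $$\lim_{n\to\infty}P\Big(\Big|\frac1n\sum_{i=1}^nX_i-\frac1n\sum_{i=1}^nE X_i\Big|<\varepsilon\Big)=1.$$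
   Context: Random variables are real-valued, defined on a common probability space with probability $P$, with finite expectation and variance. "Correlated" only means that no independence or uncorrelatedness is assumed. $E$, $\mathrm{Var}$, $\mathrm{Cov}$ denote expectation, variance and covariance. Here, for a nonnegative sequence $a_n$, the notation $a_n=O(n^s)$ means that $a_n$ is infinite of the same order as $n^s$ as $n\to\infty$, i.e. there are constants $0<c_1\le c_2$ with $c_1n^s\le a_n\le c_2n^s$ for all sufficiently large $n$. *)

theory Defs
  imports "HOL-Probability.Probability" "HOL-Library.Landau_Symbols"
begin

text \<open>
  As for \<open>prob_space.variance\<close>, the values are meaningful only when the integrals involved exist
  (e.g. for random variables with finite variance).
\<close>
definition covariance :: "'a measure \<Rightarrow> ('a \<Rightarrow> real) \<Rightarrow> ('a \<Rightarrow> real) \<Rightarrow> real" where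
  "covariance M X Y =
     (\<integral>\<omega>. (X \<omega> - (\<integral>\<omega>'. X \<omega>' \<partial>M)) * (Y \<omega> - (\<integral>\<omega>'. Y \<omega>' \<partial>M)) \<partial>M)"

text \<open>
  Two-sided growth: here \<open>a\<^sub>n = O(n\<^sup>s)\<close> means that \<open>a\<close> has exactly the order of \<open>n\<^sup>s\<close>, i.e. the
  library's \<open>\<Theta>\<close> rather than its \<open>O\<close>; the lemma spells out the constants.
\<close>
definition same_order_powr :: "(nat \<Rightarrow> real) \<Rightarrow> real \<Rightarrow> bool" where
  "same_order_powr a s \<longleftrightarrow> a \<in> \<Theta>(\<lambda>n. real n powr s)"

lemma same_order_powr_iff:
  assumes "\<And>n. 0 \<le> a n"
  shows "same_order_powr a s \<longleftrightarrow>
    (\<exists>c1 c2. 0 < c1 \<and> c1 \<le> c2 \<and>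
      (\<forall>\<^sub>F n in sequentially. c1 * real n powr s \<le> a n \<and> a n \<le> c2 * real n powr s))"
  (is "_ \<longleftrightarrow> ?R")
proof
  assume "same_order_powr a s"
  then have O: "a \<in> O(\<lambda>n. real n powr s)" and Om: "a \<in> \<Omega>(\<lambda>n. real n powr s)"
    by (auto simp: same_order_powr_def bigtheta_def)
  from O obtain d where d: "d > 0" "\<forall>\<^sub>F n in sequentially. a n \<le> d * real n powr s"
    using assms by (auto elim!: landau_o.bigE)
  from Om obtain c where c: "c > 0" "\<forall>\<^sub>F n in sequentially. c * real n powr s \<le> a n"
    using assms by (auto elim!: landau_omega.bigE)
  have "\<forall>\<^sub>F n in sequentially. c * real n powr s \<le> a n \<and> a n \<le> max c d * real n powr s"
    using c(2) d(2)
  proof eventually_elim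
    case (elim n)
    moreover have "d * real n powr s \<le> max c d * real n powr s"
      by (intro mult_right_mono) auto
    ultimately show ?case by linarith
  qed
  with c(1) show ?R by (intro exI[of _ c] exI[of _ "max c d"]) auto
next
  assume ?R
  then obtain c1 c2 where c: "0 < c1" "c1 \<le> c2"
    "\<forall>\<^sub>F n in sequentially. c1 * real n powr s \<le> a n \<and> a n \<le> c2 * real n powr s"
    by blast
  have "a \<in> O(\<lambda>n. real n powr s)"
    by (rule landau_o.bigI[of c2]) (use c assms in \<open>auto elim: eventually_mono\<close>)
  moreover have "a \<in> \<Omega>(\<lambda>n. real n powr s)"
    by (rule landau_omega.bigI[of c1]) (use c assms in \<open>auto elim: eventually_mono\<close>)
  ultimately show "same_order_powr a s"
    by (simp add: same_order_powr_def bigtheta_def)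
qed

end

theory Submission
  imports Defs "HOL-Real_Asymp.Real_Asymp"
begin

text \<open>
  By Chebyshev's inequality it suffices that the variance of \<open>(X\<^sub>1 + \<dots> + X\<^sub>n) / n\<close>
  tends to \<open>0\<close>.  Under (1), the Cauchy--Schwarz inequality bounds it by the Cesaro mean of the
  variances.  Under (2), it equals \<open>(A\<^sub>n + 2 B\<^sub>n) / n\<close> with \<open>A\<^sub>n\<close> and \<open>B\<^sub>n\<close> the normalised sums of
  (a) and (b), both of which are \<open>o(n)\<close>.
\<close>

text \<open>Beyond some index \<open>N\<close> all terms are below \<open>e / 2\<close> in absolute
  value. The head contributes at most a constant independent of \<open>n\<close>, which division by
  \<open>n\<close> makes negligible.\<close>

lemma cesaro_mean_tendsto_0:
  fixes f :: "nat \<Rightarrow> real"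
  assumes "f \<longlonglongrightarrow> 0"
  shows "(\<lambda>n. (\<Sum>i=1..n. f i) / real n) \<longlonglongrightarrow> 0"
proof (rule LIMSEQ_I)
  fix e :: real
  assume e: "0 < e"
  then obtain N where N: "\<And>n. n \<ge> N \<Longrightarrow> \<bar>f n\<bar> < e / 2"
    using LIMSEQ_D[OF assms, of "e / 2"] by auto
  \<comment> \<open>The index 0 lies outside the range of the mean, but since the summands are
    absolute values \<open>K\<close> still bounds the head from above.\<close>
  define K where "K = (\<Sum>i<N. \<bar>f i\<bar>)"
  have bound: "\<bar>\<Sum>i=1..n. f i\<bar> \<le> K + real n * (e / 2)" for n
  proof -
    have "\<bar>\<Sum>i=1..n. f i\<bar> \<le> (\<Sum>i=1..n. \<bar>f i\<bar>)"
      by (rule sum_abs)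
    \<comment> \<open>Every index, including those of the head, is granted \<open>e / 2\<close>, so
      that this share sums to exactly \<open>n * (e / 2)\<close>.\<close>
    also have "\<dots> \<le> (\<Sum>i=1..n. (if i < N then \<bar>f i\<bar> else 0) + e / 2)"
      using N e by (intro sum_mono) (auto simp: not_less intro: less_imp_le)
    also have "\<dots> = (\<Sum>i\<in>{1..n} \<inter> {..<N}. \<bar>f i\<bar>) + real n * (e / 2)"
      by (simp add: sum.distrib sum.inter_restrict lessThan_def)
    also have "(\<Sum>i\<in>{1..n} \<inter> {..<N}. \<bar>f i\<bar>) \<le> K"
      unfolding K_def by (rule sum_mono2) auto
    finally show ?thesis by simp
  qed
  \<comment> \<open>Once \<open>n\<close> exceeds \<open>2 * K / e\<close>, the head
    \<open>K\<close> takes up less than the other half of \<open>n * e\<close>.\<close>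
  obtain m where m: "real m > 2 * K / e"
    using reals_Archimedean2 by blast
  show "\<exists>no. \<forall>n\<ge>no. norm ((\<Sum>i=1..n. f i) / real n - 0) < e"
  proof (intro exI allI impI)
    fix n assume n: "n \<ge> Suc m"
    then have "2 * K / e < real n"
      using m by linarith
    then have "K < real n * (e / 2)"
      using e by (simp add: field_simps)
    then have "\<bar>\<Sum>i=1..n. f i\<bar> < real n * e"
      using bound[of n] by (simp add: field_simps)
    then show "norm ((\<Sum>i=1..n. f i) / real n - 0) < e"
      using n by (simp add: field_simps)
  qed
qed

text \<open>Passing from \<open>n\<close> to \<open>Suc n\<close> adds exactly the pairs
  \<open>(i, Suc n)\<close> with \<open>i\<close> in \<open>{1..n}\<close>, and these give the cross
  term of the binomial square. The identity is later applied pointwise under the integral.\<close>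

lemma square_sum_eq_diagonal_off_diagonal:
  fixes a :: "nat \<Rightarrow> 'a :: comm_ring_1"
  shows "(\<Sum>i=1..n. a i)\<^sup>2 =
    (\<Sum>i=1..n. (a i)\<^sup>2) + 2 * (\<Sum>(i, j) | 1 \<le> i \<and> i < j \<and> j \<le> n. a i * a j)"
proof (induction n)
  case 0
  have "{(i, j). 1 \<le> i \<and> i < j \<and> j \<le> (0::nat)} = {}"
    by auto
  then show ?case by (simp only: sum.empty) simp
next
  case (Suc n)
  let ?P = "\<lambda>n. {(i, j). 1 \<le> i \<and> i < j \<and> j \<le> (n::nat)}"
  have fin: "finite (?P n)"
    by (rule finite_subset[of _ "{..n} \<times> {..n}"]) auto
  have "?P (Suc n) = ?P n \<union> (\<lambda>i. (i, Suc n)) ` {1..n}"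
    by auto
  then have "(\<Sum>(i, j)\<in>?P (Suc n). a i * a j) =
      (\<Sum>(i, j)\<in>?P n. a i * a j) + (\<Sum>(i, j)\<in>(\<lambda>i. (i, Suc n)) ` {1..n}. a i * a j)"
    using fin by (simp only:, intro sum.union_disjoint) auto
  also have "(\<Sum>(i, j)\<in>(\<lambda>i. (i, Suc n)) ` {1..n}. a i * a j) = (\<Sum>i=1..n. a i) * a (Suc n)"
    by (subst sum.reindex) (auto simp: inj_on_def sum_distrib_right)
  finally show ?case
    using Suc by (simp add: power2_sum algebra_simps)
qed

text \<open>A bounded sequence is \<open>O(1)\<close>, and one of the order of
  \<open>n powr s\<close> with \<open>s < 1\<close> is dominated by that power; both 1 and the power
  are \<open>o(n)\<close>.\<close>

lemma bounded_or_same_order_imp_smallo: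
  assumes "(\<forall>n\<ge>1. \<bar>a n\<bar> < C) \<or> same_order_powr (\<lambda>n. \<bar>a n\<bar>) s" and "s < 1"
  shows "(\<lambda>n. a n / real n) \<longlonglongrightarrow> 0"
proof -
  have "a \<in> o(\<lambda>n. real n)"
    using assms(1)
  proof
    assume b: "\<forall>n\<ge>1. \<bar>a n\<bar> < C"
    have "a \<in> O(\<lambda>_. 1)"
      by (rule bigoI[of _ C]) (use b in \<open>auto intro!: eventually_sequentiallyI[of 1] less_imp_le\<close>)
    also have "(\<lambda>_. 1) \<in> o(\<lambda>n. real n)"
      by real_asymp
    finally show ?thesis .
  next
    assume "same_order_powr (\<lambda>n. \<bar>a n\<bar>) s"
    then have "a \<in> O(\<lambda>n. real n powr s)"
      by (simp add: same_order_powr_def bigtheta_def)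
    also have "(\<lambda>n. real n powr s) \<in> o(\<lambda>n. real n)"
      using \<open>s < 1\<close> by real_asymp
    finally show ?thesis .
  qed
  then show ?thesis
    by (rule smalloD_tendsto)
qed

context prob_space
begin

text \<open>Expanding the square of the difference of the absolute values shows that the product is
  dominated by the sum of the squares. This makes the covariances genuine integrals.\<close>

lemma integrable_mult_of_square_integrable:
  fixes Y Z :: "'a \<Rightarrow> real"
  assumes [measurable]: "random_variable borel Y" "random_variable borel Z"
    and "integrable M (\<lambda>\<omega>. (Y \<omega>)\<^sup>2)" "integrable M (\<lambda>\<omega>. (Z \<omega>)\<^sup>2)"
  shows "integrable M (\<lambda>\<omega>. Y \<omega> * Z \<omega>)"
proof (rule Bochner_Integration.integrable_bound)
  show "integrable M (\<lambda>\<omega>. (Y \<omega>)\<^sup>2 + (Z \<omega>)\<^sup>2)"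
    using assms by simp
  show "AE \<omega> in M. norm (Y \<omega> * Z \<omega>) \<le> norm ((Y \<omega>)\<^sup>2 + (Z \<omega>)\<^sup>2)"
  proof (rule AE_I2)
    fix \<omega>
    have "2 * \<bar>Y \<omega>\<bar> * \<bar>Z \<omega>\<bar> \<le> (Y \<omega>)\<^sup>2 + (Z \<omega>)\<^sup>2"
      using sum_squares_bound[of "\<bar>Y \<omega>\<bar>" "\<bar>Z \<omega>\<bar>"] by simp
    moreover have "0 \<le> \<bar>Y \<omega>\<bar> * \<bar>Z \<omega>\<bar>"
      by simp
    ultimately have "\<bar>Y \<omega>\<bar> * \<bar>Z \<omega>\<bar> \<le> (Y \<omega>)\<^sup>2 + (Z \<omega>)\<^sup>2"
      by linarith
    then show "norm (Y \<omega> * Z \<omega>) \<le> norm ((Y \<omega>)\<^sup>2 + (Z \<omega>)\<^sup>2)"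
      by (simp add: abs_mult)
  qed
qed measurable

text \<open>Chebyshev's inequality in second-moment form bounds the complementary event, so the
  probability is squeezed between a lower bound tending to 1 and the trivial upper bound 1.\<close>

lemma tendsto_prob_abs_less_of_second_moment:
  fixes Z :: "nat \<Rightarrow> 'a \<Rightarrow> real"
  assumes Z [measurable]: "\<And>n. random_variable borel (Z n)"
    and int: "\<And>n. integrable M (\<lambda>\<omega>. (Z n \<omega>)\<^sup>2)"
    and lim: "(\<lambda>n. expectation (\<lambda>\<omega>. (Z n \<omega>)\<^sup>2)) \<longlonglongrightarrow> 0"
    and "\<epsilon> > 0"
  shows "(\<lambda>n. \<P>(\<omega> in M. \<bar>Z n \<omega>\<bar> < \<epsilon>)) \<longlonglongrightarrow> 1"
proof (rule tendsto_sandwich)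
  have "1 - expectation (\<lambda>\<omega>. (Z n \<omega>)\<^sup>2) / \<epsilon>\<^sup>2 \<le> \<P>(\<omega> in M. \<bar>Z n \<omega>\<bar> < \<epsilon>)" for n
  proof -
    have "\<P>(\<omega> in M. \<bar>Z n \<omega>\<bar> < \<epsilon>) = 1 - \<P>(\<omega> in M. \<not> \<bar>Z n \<omega>\<bar> < \<epsilon>)"
      by (subst prob_neg) auto
    moreover have "\<P>(\<omega> in M. \<not> \<bar>Z n \<omega>\<bar> < \<epsilon>) \<le> expectation (\<lambda>\<omega>. (Z n \<omega>)\<^sup>2) / \<epsilon>\<^sup>2"
      using second_moment_method[OF Z int \<open>\<epsilon> > 0\<close>] by (simp add: not_less)
    ultimately show ?thesis by simp
  qed
  then show "\<forall>\<^sub>F n in sequentially.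
      1 - expectation (\<lambda>\<omega>. (Z n \<omega>)\<^sup>2) / \<epsilon>\<^sup>2 \<le> \<P>(\<omega> in M. \<bar>Z n \<omega>\<bar> < \<epsilon>)"
    by simp
  show "(\<lambda>n. 1 - expectation (\<lambda>\<omega>. (Z n \<omega>)\<^sup>2) / \<epsilon>\<^sup>2) \<longlonglongrightarrow> 1"
    using tendsto_diff[OF tendsto_const tendsto_divide_zero[OF lim], of 1] by simp
qed auto

text \<open>The pointwise expansion of the square is integrated term by term, which is legitimate
  because all squares and mixed products are integrable. For centred variables this is the variance
  of a sum.\<close>

lemma expectation_square_sum:
  fixes Y :: "nat \<Rightarrow> 'a \<Rightarrow> real"
  assumes "\<And>i. i \<ge> 1 \<Longrightarrow> random_variable borel (Y i)"
    and "\<And>i. i \<ge> 1 \<Longrightarrow> integrable M (\<lambda>\<omega>. (Y i \<omega>)\<^sup>2)"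
  shows "integrable M (\<lambda>\<omega>. (\<Sum>i=1..n. Y i \<omega>)\<^sup>2)"
    and "expectation (\<lambda>\<omega>. (\<Sum>i=1..n. Y i \<omega>)\<^sup>2) =
      (\<Sum>i=1..n. expectation (\<lambda>\<omega>. (Y i \<omega>)\<^sup>2)) +
      2 * (\<Sum>(i, j) | 1 \<le> i \<and> i < j \<and> j \<le> n. expectation (\<lambda>\<omega>. Y i \<omega> * Y j \<omega>))"
proof -
  have prod: "integrable M (\<lambda>\<omega>. Y i \<omega> * Y j \<omega>)" if "1 \<le> i" "1 \<le> j" for i j
    using assms that by (intro integrable_mult_of_square_integrable)
  \<comment> \<open>This restates \<open>prod\<close> for a single pair \<open>p\<close>, the shape
    in which the summand occurs when the integral is moved inside the sum over pairs.\<close>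
  have off: "integrable M (\<lambda>\<omega>. case p of (i, j) \<Rightarrow> Y i \<omega> * Y j \<omega>)"
    if "p \<in> {(i, j). 1 \<le> i \<and> i < j \<and> j \<le> n}" for p
    using that by (auto intro!: prod)
  show "integrable M (\<lambda>\<omega>. (\<Sum>i=1..n. Y i \<omega>)\<^sup>2)"
    unfolding square_sum_eq_diagonal_off_diagonal
    using assms(2) off
    by (intro Bochner_Integration.integrable_add Bochner_Integration.integrable_sum
        integrable_mult_right) auto
  have "expectation (\<lambda>\<omega>. (\<Sum>i=1..n. Y i \<omega>)\<^sup>2) =
      (\<Sum>i=1..n. expectation (\<lambda>\<omega>. (Y i \<omega>)\<^sup>2)) +
      2 * (\<Sum>p\<in>{(i, j). 1 \<le> i \<and> i < j \<and> j \<le> n}.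
        expectation (\<lambda>\<omega>. case p of (i, j) \<Rightarrow> Y i \<omega> * Y j \<omega>))"
    unfolding square_sum_eq_diagonal_off_diagonal
    using assms(2) off
    by (subst Bochner_Integration.integral_add)
      (auto intro!: Bochner_Integration.integrable_sum integrable_mult_right
        simp: Bochner_Integration.integral_sum simp del: One_nat_def)
  then show "expectation (\<lambda>\<omega>. (\<Sum>i=1..n. Y i \<omega>)\<^sup>2) =
      (\<Sum>i=1..n. expectation (\<lambda>\<omega>. (Y i \<omega>)\<^sup>2)) +
      2 * (\<Sum>(i, j) | 1 \<le> i \<and> i < j \<and> j \<le> n. expectation (\<lambda>\<omega>. Y i \<omega> * Y j \<omega>))"
    by (simp add: case_prod_unfold)
qed

text \<open>Cauchy-Schwarz against the constant vector 1, applied pointwise and then integrated,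
  gives a bound in which no mixed moments occur.\<close>

lemma expectation_square_sum_le:
  fixes Y :: "nat \<Rightarrow> 'a \<Rightarrow> real"
  assumes "\<And>i. i \<ge> 1 \<Longrightarrow> random_variable borel (Y i)"
    and "\<And>i. i \<ge> 1 \<Longrightarrow> integrable M (\<lambda>\<omega>. (Y i \<omega>)\<^sup>2)"
  shows "expectation (\<lambda>\<omega>. (\<Sum>i=1..n. Y i \<omega>)\<^sup>2) \<le>
    real n * (\<Sum>i=1..n. expectation (\<lambda>\<omega>. (Y i \<omega>)\<^sup>2))"
proof -
  have "expectation (\<lambda>\<omega>. (\<Sum>i=1..n. Y i \<omega>)\<^sup>2) \<le> expectation (\<lambda>\<omega>. real n * (\<Sum>i=1..n. (Y i \<omega>)\<^sup>2))"
  proof (rule integral_mono)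
    show "integrable M (\<lambda>\<omega>. (\<Sum>i=1..n. Y i \<omega>)\<^sup>2)"
      using assms by (rule expectation_square_sum)
    show "(\<Sum>i=1..n. Y i \<omega>)\<^sup>2 \<le> real n * (\<Sum>i=1..n. (Y i \<omega>)\<^sup>2)" for \<omega>
      using sum_squared_le_sum_of_squares[of "\<lambda>i. Y i \<omega>" "{1..n}"] by (simp add: mult.commute)
  qed (use assms(2) in auto)
  also have "\<dots> = real n * (\<Sum>i=1..n. expectation (\<lambda>\<omega>. (Y i \<omega>)\<^sup>2))"
    using assms(2) by (simp add: Bochner_Integration.integral_sum)
  finally show ?thesis .
qed

end

theorem theorem13:
  fixes M :: "'a measure" and X :: "nat \<Rightarrow> 'a \<Rightarrow> real"
  assumes "prob_space M"
    and "\<And>i. i \<ge> 1 \<Longrightarrow> prob_space.random_variable M borel (X i)"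
    and "\<And>i. i \<ge> 1 \<Longrightarrow> integrable M (X i)"
    and "\<And>i. i \<ge> 1 \<Longrightarrow> integrable M (\<lambda>\<omega>. (X i \<omega> - prob_space.expectation M (X i))\<^sup>2)"
    and "((\<lambda>n. prob_space.variance M (X n)) \<longlonglongrightarrow> 0) \<or>
      (\<exists>C s :: real. C > 0 \<and> 0 < s \<and> s < 1 \<and>
        ((\<forall>n\<ge>1. \<bar>1 / real n * (\<Sum>i=1..n. prob_space.variance M (X i))\<bar> < C) \<or>
         same_order_powr (\<lambda>n. \<bar>1 / real n * (\<Sum>i=1..n. prob_space.variance M (X i))\<bar>) s) \<and>
        ((\<forall>n\<ge>1. \<bar>1 / real n * (\<Sum>(i, j) | 1 \<le> i \<and> i < j \<and> j \<le> n. covariance M (X i) (X j))\<bar> < C) \<or>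
         same_order_powr
           (\<lambda>n. \<bar>1 / real n * (\<Sum>(i, j) | 1 \<le> i \<and> i < j \<and> j \<le> n. covariance M (X i) (X j))\<bar>) s))"
  shows "\<forall>\<epsilon>>0. (\<lambda>n. \<P>(\<omega> in M.
      \<bar>1 / real n * (\<Sum>i=1..n. X i \<omega>) - 1 / real n * (\<Sum>i=1..n. prob_space.expectation M (X i))\<bar> < \<epsilon>))
    \<longlonglongrightarrow> 1"
proof (intro allI impI)
  fix \<epsilon> :: real
  assume "\<epsilon> > 0"
  interpret prob_space M by fact
  \<comment> \<open>After centring, second moments are variances and mixed moments are
    covariances.\<close>
  define Y where "Y i \<omega> = X i \<omega> - expectation (X i)" for i \<omega>
  define Z where "Z n \<omega> = (\<Sum>i=1..n. Y i \<omega>) / real n" for n \<omega>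
  define A where "A n = 1 / real n * (\<Sum>i=1..n. variance (X i))" for n
  define B where "B n = 1 / real n *
    (\<Sum>(i, j) | 1 \<le> i \<and> i < j \<and> j \<le> n. covariance M (X i) (X j))" for n
  have Y: "random_variable borel (Y i)" if "i \<ge> 1" for i
    using assms(2)[OF that] unfolding Y_def by measurable
  have Y2: "integrable M (\<lambda>\<omega>. (Y i \<omega>)\<^sup>2)" if "i \<ge> 1" for i
    using assms(4)[OF that] by (simp add: Y_def)
  have Z2_eq: "expectation (\<lambda>\<omega>. (Z n \<omega>)\<^sup>2) = expectation (\<lambda>\<omega>. (\<Sum>i=1..n. Y i \<omega>)\<^sup>2) / (real n)\<^sup>2" for n
    by (simp add: Z_def power_divide)
  have "(\<lambda>n. expectation (\<lambda>\<omega>. (Z n \<omega>)\<^sup>2)) \<longlonglongrightarrow> 0"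
    using assms(5)
  proof
    assume lim: "(\<lambda>n. variance (X n)) \<longlonglongrightarrow> 0"
    show ?thesis
    proof (rule tendsto_sandwich[of "\<lambda>_. 0"])
      show "(\<lambda>n. (\<Sum>i=1..n. variance (X i)) / real n) \<longlonglongrightarrow> 0"
        by (rule cesaro_mean_tendsto_0[OF lim])
      have "expectation (\<lambda>\<omega>. (Z n \<omega>)\<^sup>2) \<le> (\<Sum>i=1..n. variance (X i)) / real n" for n
      proof -
        have "expectation (\<lambda>\<omega>. (Z n \<omega>)\<^sup>2) \<le>
            real n * (\<Sum>i=1..n. expectation (\<lambda>\<omega>. (Y i \<omega>)\<^sup>2)) / (real n)\<^sup>2"
          unfolding Z2_eq by (intro divide_right_mono expectation_square_sum_le Y Y2) auto
        also have "\<dots> = (\<Sum>i=1..n. variance (X i)) / real n"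
          \<comment> \<open>For \<open>n = 0\<close> both sides are 0, since division by zero yields
            0; otherwise one factor \<open>n\<close> cancels.\<close>
          by (cases "n = 0") (simp_all add: Y_def power2_eq_square)
        finally show ?thesis .
      qed
      then show "\<forall>\<^sub>F n in sequentially.
          expectation (\<lambda>\<omega>. (Z n \<omega>)\<^sup>2) \<le> (\<Sum>i=1..n. variance (X i)) / real n"
        by simp
    qed auto
  next
    assume "\<exists>C s :: real. C > 0 \<and> 0 < s \<and> s < 1 \<and>
        ((\<forall>n\<ge>1. \<bar>1 / real n * (\<Sum>i=1..n. variance (X i))\<bar> < C) \<or>
         same_order_powr (\<lambda>n. \<bar>1 / real n * (\<Sum>i=1..n. variance (X i))\<bar>) s) \<and>
        ((\<forall>n\<ge>1. \<bar>1 / real n * (\<Sum>(i, j) | 1 \<le> i \<and> i < j \<and> j \<le> n. covariance M (X i) (X j))\<bar> < C) \<or>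
         same_order_powr
           (\<lambda>n. \<bar>1 / real n * (\<Sum>(i, j) | 1 \<le> i \<and> i < j \<and> j \<le> n. covariance M (X i) (X j))\<bar>) s)"
    then obtain C s where "s < 1"
      and a: "(\<forall>n\<ge>1. \<bar>A n\<bar> < C) \<or> same_order_powr (\<lambda>n. \<bar>A n\<bar>) s"
      and b: "(\<forall>n\<ge>1. \<bar>B n\<bar> < C) \<or> same_order_powr (\<lambda>n. \<bar>B n\<bar>) s"
      unfolding A_def B_def by blast
    have "(\<lambda>n. A n / real n) \<longlonglongrightarrow> 0"
      using a \<open>s < 1\<close> by (rule bounded_or_same_order_imp_smallo)
    moreover have "(\<lambda>n. B n / real n) \<longlonglongrightarrow> 0"
      using b \<open>s < 1\<close> by (rule bounded_or_same_order_imp_smallo)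
    ultimately have "(\<lambda>n. A n / real n + 2 * (B n / real n)) \<longlonglongrightarrow> 0"
      by (intro tendsto_add_zero tendsto_mult_right_zero)
    \<comment> \<open>The second moment of the mean carries the square of \<open>1 / n\<close>, of
      which \<open>A\<close> and \<open>B\<close> already contain one factor. The case
      \<open>n = 0\<close> again holds because division by zero yields 0.\<close>
    moreover have "expectation (\<lambda>\<omega>. (Z n \<omega>)\<^sup>2) = A n / real n + 2 * (B n / real n)" for n
    proof -
      have "expectation (\<lambda>\<omega>. (\<Sum>i=1..n. Y i \<omega>)\<^sup>2) = (\<Sum>i=1..n. variance (X i)) +
          2 * (\<Sum>(i, j) | 1 \<le> i \<and> i < j \<and> j \<le> n. covariance M (X i) (X j))"
        using expectation_square_sum(2)[of Y n, OF Y Y2] by (simp add: Y_def covariance_def)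
      then show ?thesis
        unfolding Z2_eq A_def B_def by (simp add: power2_eq_square add_divide_distrib)
    qed
    ultimately show ?thesis by simp
  qed
  moreover have "random_variable borel (Z n)" for n
    unfolding Z_def using Y by (intro borel_measurable_divide borel_measurable_sum) auto
  moreover have "integrable M (\<lambda>\<omega>. (Z n \<omega>)\<^sup>2)" for n
    using expectation_square_sum(1)[OF Y Y2] by (simp add: Z_def power_divide)
  ultimately have "(\<lambda>n. \<P>(\<omega> in M. \<bar>Z n \<omega>\<bar> < \<epsilon>)) \<longlonglongrightarrow> 1"
    using \<open>\<epsilon> > 0\<close> by (intro tendsto_prob_abs_less_of_second_moment)
  then show "(\<lambda>n. \<P>(\<omega> in M.
      \<bar>1 / real n * (\<Sum>i=1..n. X i \<omega>) - 1 / real n * (\<Sum>i=1..n. expectation (X i))\<bar> < \<epsilon>))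
    \<longlonglongrightarrow> 1"
    by (simp add: Z_def Y_def sum_subtractf diff_divide_distrib)
qed

end
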